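(* For all integers $n \geq 2$ and $s \geq 2$, $\operatorname{dmg}(P_n; s) = n-2$, where $P_n$ is the path on $n$ vertices.
   Context: The game with one cop and $s$ robbers on a finite simple graph $G$ is a perfect-information game. In round $0$ the cop chooses an initial vertex, and then each robber chooses an initial vertex (several robbers may share a vertex). Each subsequent round consists of a turn for the cop followed by a turn for the robbers; on their turn, each player may stay put or move to a neighboring vertex (on the robbers' turn every uncaptured robber may do so). Whenever the cop occupies the same vertex as one or more robbers, all those robbers are captured and take no further part in the game. If a robber occupies a vertex $v$ at the end of some round (including round $0$) and that robber is not captured in the following round, then $v$ becomes damaged (and stays damaged). The robbers aim to maximize, and the cop aims to minimize, the total number of damaged vertices. The $s$-robber damage number $\operatorname{dmg}(G;s)$ is the number of vertices damaged under optimal play, i.e. the smallest $d$ such that the cop has a strategy guaranteeing that at most $d$ vertices are ever damaged, whatever the $s$ robbers do. *)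

theory Defs
  imports "Graph_Theory.Pair_Digraph"
begin

text \<open>
  Finite simple graphs are the \<^locale>\<open>pair_graph\<close>s of the library: finite, symmetric and loopfree.
  A robber configuration is a list with one entry per robber: \<open>Some v\<close> for an uncaptured robber
  on \<open>v\<close>, \<open>None\<close> for a captured one. In a play, \<open>c t\<close> is the position of the cop and \<open>r t\<close> the
  robber configuration at the end of round \<open>t\<close>.
\<close>

definition step :: "'a pair_pre_digraph \<Rightarrow> 'a \<Rightarrow> 'a \<Rightarrow> bool" where
  "step G u v \<longleftrightarrow> v \<in> pverts G \<and> (v = u \<or> (u, v) \<in> parcs G)"

definition capture :: "'a \<Rightarrow> 'a option list \<Rightarrow> 'a option list" where
  "capture x rs = map (\<lambda>y. if y = Some x then None else y) rs"

definition robbers_turn ::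
    "'a pair_pre_digraph \<Rightarrow> 'a option list \<Rightarrow> 'a option list \<Rightarrow> bool" where
  "robbers_turn G rs rs' \<longleftrightarrow> list_all2 (rel_option (step G)) rs rs'"

text \<open>
  In every round, captures happen both when the cop has moved onto robbers and when robbers have
  moved (or, in round 0, have been placed) onto the cop.
\<close>

definition play ::
    "'a pair_pre_digraph \<Rightarrow> nat \<Rightarrow> (nat \<Rightarrow> 'a) \<Rightarrow> (nat \<Rightarrow> 'a option list) \<Rightarrow> bool" where
  "play G s c r \<longleftrightarrow>
     c 0 \<in> pverts G \<and>
     (\<exists>vs. length vs = s \<and> set vs \<subseteq> pverts G \<and> r 0 = capture (c 0) (map Some vs)) \<and>
     (\<forall>t. step G (c t) (c (Suc t)) \<and>
          (\<exists>rs. robbers_turn G (capture (c (Suc t)) (r t)) rs \<and>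
                r (Suc t) = capture (c (Suc t)) rs))"

definition damaged :: "(nat \<Rightarrow> 'a option list) \<Rightarrow> 'a set" where
  "damaged r = {v. \<exists>t i. i < length (r t) \<and> r t ! i = Some v \<and> r (Suc t) ! i \<noteq> None}"

text \<open>
  A strategy of the cop maps the positions at the end of all past rounds to the vertex the cop
  occupies next; on the empty history it yields the initial vertex.
\<close>

definition cop_strategy ::
    "'a pair_pre_digraph \<Rightarrow> (('a \<times> 'a option list) list \<Rightarrow> 'a) \<Rightarrow> bool" where
  "cop_strategy G \<sigma> \<longleftrightarrow>
     \<sigma> [] \<in> pverts G \<and>
     (\<forall>h. h \<noteq> [] \<and> fst (last h) \<in> pverts G \<longrightarrow> step G (fst (last h)) (\<sigma> h))"

definition follows ::
    "(('a \<times> 'a option list) list \<Rightarrow> 'a) \<Rightarrow> (nat \<Rightarrow> 'a) \<Rightarrow> (nat \<Rightarrow> 'a option list) \<Rightarrow> bool" where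
  "follows \<sigma> c r \<longleftrightarrow> (\<forall>t. c t = \<sigma> (map (\<lambda>k. (c k, r k)) [0..<t]))"

definition guarantees ::
    "'a pair_pre_digraph \<Rightarrow> nat \<Rightarrow> (('a \<times> 'a option list) list \<Rightarrow> 'a) \<Rightarrow> nat \<Rightarrow> bool" where
  "guarantees G s \<sigma> d \<longleftrightarrow>
     (\<forall>c r. play G s c r \<and> follows \<sigma> c r \<longrightarrow> card (damaged r) \<le> d)"

definition dmg :: "'a pair_pre_digraph \<Rightarrow> nat \<Rightarrow> nat" where
  "dmg G s = (LEAST d. \<exists>\<sigma>. cop_strategy G \<sigma> \<and> guarantees G s \<sigma> d)"

definition path_graph :: "nat \<Rightarrow> nat pair_pre_digraph" where
  "path_graph n =
     \<lparr> pverts = {0..<n}, parcs = {(i, j). i < n \<and> j < n \<and> (j = Suc i \<or> i = Suc j)} \<rparr>"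

lemma pair_graph_path_graph: "pair_graph (path_graph n)"
proof -
  have "finite (parcs (path_graph n))"
    by (rule finite_subset[of _ "{0..<n} \<times> {0..<n}"]) (auto simp: path_graph_def)
  then show ?thesis
    by unfold_locales (auto simp: path_graph_def symmetric_def sym_def)
qed

text \<open>The set of damaged vertices is finite, and the least value in \<^const>\<open>dmg\<close> is attained.\<close>

lemma play_in_pverts:
  assumes "play G s c r"
  shows "Some v \<in> set (r t) \<Longrightarrow> v \<in> pverts G"
proof (cases t)
  case 0
  assume "Some v \<in> set (r t)"
  with 0 assms show ?thesis by (auto simp: play_def capture_def split: if_splits)
next
  case (Suc t')
  assume v: "Some v \<in> set (r t)"
  obtain rs where rs: "robbers_turn G (capture (c (Suc t')) (r t')) rs"
    "r (Suc t') = capture (c (Suc t')) rs"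
    using assms by (auto simp: play_def)
  from v Suc rs(2) have "Some v \<in> set rs" by (auto simp: capture_def split: if_splits)
  with rs(1) obtain x where "rel_option (step G) x (Some v)"
    unfolding robbers_turn_def by (metis in_set_conv_nth list_all2_conv_all_nth)
  then show ?thesis by (cases x) (auto simp: step_def)
qed

lemma damaged_subset: "play G s c r \<Longrightarrow> damaged r \<subseteq> pverts G"
  unfolding damaged_def using play_in_pverts by (fastforce simp: in_set_conv_nth)

lemma dmg_attained:
  assumes "finite (pverts G)" "pverts G \<noteq> {}"
  shows "\<exists>\<sigma>. cop_strategy G \<sigma> \<and> guarantees G s \<sigma> (dmg G s)"
proof -
  obtain v where "v \<in> pverts G" using assms(2) by blast
  then have "cop_strategy G (\<lambda>h. if h = [] then v else fst (last h))"
    by (auto simp: cop_strategy_def step_def)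
  moreover have "guarantees G s (\<lambda>h. if h = [] then v else fst (last h)) (card (pverts G))"
    using assms(1) by (auto simp: guarantees_def intro: card_mono dest: damaged_subset)
  ultimately have "\<exists>\<sigma>. cop_strategy G \<sigma> \<and> guarantees G s \<sigma> (card (pverts G))" by blast
  then show ?thesis unfolding dmg_def by (rule LeastI)
qed

end

theory Submission
  imports Defs
begin

text \<open>
  Upper bound: the cop visits 1, 0, 1 and then stays on 1. Robbers starting on 0 are caught at
  once, all others can never damage 0 or 1.

  Lower bound: let the cop start on \<open>a\<close>, without loss of generality in the left half. One robber
  starts on \<open>a - 2\<close>, runs to 0, waits there for one round, returns and enters \<open>a - 1\<close>. Another one
  shadows the cop at distance 2 on its right, and flees to the right end once the cop has been
  left of \<open>a\<close> or the first robber's trip is over. The second robber damages everything from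
  \<open>a + 2\<close> on, the first one everything up to \<open>a - 2\<close>. If the cop stays on or right of \<open>a\<close> during
  the trip, then \<open>a - 1\<close> is damaged as well; if it moves left of \<open>a\<close>, then the second robber
  damages \<open>a + 1\<close>, since the trip is too short for the cop to have been at the far right end before.
\<close>

section \<open>Plays built from trajectories that ignore captures\<close>

definition walk :: "'a pair_pre_digraph \<Rightarrow> (nat \<Rightarrow> 'a) \<Rightarrow> bool" where
  "walk G p \<longleftrightarrow> p 0 \<in> pverts G \<and> (\<forall>t. step G (p t) (p (Suc t)))"

text \<open>The first clause excludes a robber being placed on or stepping onto the cop, the second
  the cop stepping onto a robber.\<close>

definition uncaught :: "(nat \<Rightarrow> 'a) \<Rightarrow> (nat \<Rightarrow> 'a) \<Rightarrow> nat \<Rightarrow> bool" where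
  "uncaught c p t \<longleftrightarrow> (\<forall>u\<le>t. p u \<noteq> c u) \<and> (\<forall>u<t. p u \<noteq> c (Suc u))"

definition spoiled :: "(nat \<Rightarrow> 'a) \<Rightarrow> (nat \<Rightarrow> 'a) \<Rightarrow> 'a set" where
  "spoiled c p = {p t | t. uncaught c p (Suc t)}"

text \<open>The bound \<open>u \<le> t\<close> includes round \<open>t\<close> itself, since in each
  round the robbers answer after the cop.\<close>

definition causal :: "((nat \<Rightarrow> 'a) \<Rightarrow> nat \<Rightarrow> 'a) \<Rightarrow> bool" where
  "causal q \<longleftrightarrow> (\<forall>c c' t. (\<forall>u\<le>t. c u = c' u) \<longrightarrow> q c t = q c' t)"

text \<open>
  A robber is described by the trajectory it would follow if captures were ignored, as a function
  of the cop's trajectory; the actual configuration is obtained by deleting captured robbers.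
\<close>

definition config ::
    "nat \<Rightarrow> (nat \<Rightarrow> (nat \<Rightarrow> 'a) \<Rightarrow> nat \<Rightarrow> 'a) \<Rightarrow> (nat \<Rightarrow> 'a) \<Rightarrow> nat \<Rightarrow> 'a option list" where
  "config s q c t =
     map (\<lambda>i. if uncaught c (q i c) t then Some (q i c t) else None) [0..<s]"

lemma causalD: "causal q \<Longrightarrow> (\<And>u. u \<le> t \<Longrightarrow> c u = c' u) \<Longrightarrow> q c t = q c' t"
  unfolding causal_def by simp

lemma walk_in_pverts: "walk G p \<Longrightarrow> p t \<in> pverts G"
  by (cases t) (auto simp: walk_def step_def)

lemma uncaught_0: "uncaught c p 0 \<longleftrightarrow> p 0 \<noteq> c 0"
  by (simp add: uncaught_def)

lemma uncaught_Suc: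
  "uncaught c p (Suc t) \<longleftrightarrow> uncaught c p t \<and> p t \<noteq> c (Suc t) \<and> p (Suc t) \<noteq> c (Suc t)"
  by (auto simp: uncaught_def le_Suc_eq less_Suc_eq)

lemma config_cong:
  assumes "\<And>i. causal (q i)" "\<And>u. u \<le> t \<Longrightarrow> c u = c' u"
  shows "config s q c t = config s q c' t"
proof -
  have "q i c u = q i c' u" if "u \<le> t" for i u
    using assms(2) that by (intro causalD[OF assms(1)]) auto
  then show ?thesis
    using assms(2) by (auto simp: config_def uncaught_def)
qed

lemma damaged_config: "damaged (config s q c) = (\<Union>i<s. spoiled c (q i c))"
  by (fastforce simp: damaged_def config_def spoiled_def uncaught_Suc split: if_splits)

lemma play_config:
  assumes "walk G c" "\<And>i. walk G (q i c)"
  shows "play G s c (config s q c)"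
  unfolding play_def
proof (intro conjI allI)
  show "c 0 \<in> pverts G" using assms(1) by (simp add: walk_def)
  show "\<exists>vs. length vs = s \<and> set vs \<subseteq> pverts G \<and>
      config s q c 0 = capture (c 0) (map Some vs)"
    by (rule exI[of _ "map (\<lambda>i. q i c 0) [0..<s]"])
      (use assms(2) in \<open>auto simp: config_def capture_def uncaught_0 walk_def\<close>)
  fix t
  show "step G (c t) (c (Suc t))" using assms(1) by (simp add: walk_def)
  show "\<exists>rs. robbers_turn G (capture (c (Suc t)) (config s q c t)) rs \<and>
      config s q c (Suc t) = capture (c (Suc t)) rs"
    \<comment> \<open>The witness is the configuration in mid-round: robbers that survive the cop's
      move have stepped, and captures by stepping onto the cop are still pending.\<close>
    by (rule exI[of _ "map (\<lambda>i. if uncaught c (q i c) t \<and> q i c t \<noteq> c (Suc t)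
            then Some (q i c (Suc t)) else None) [0..<s]"])
      (use assms(2) in \<open>auto simp: config_def capture_def uncaught_Suc walk_def
        robbers_turn_def list_all2_conv_all_nth\<close>)
qed

text \<open>Causality removes the circularity between \<open>\<sigma>\<close> and \<open>q\<close>:
  the configuration of a round depends only on the cop's vertices so far, so the history can be
  built by recursion. Legality is asked only for walks from \<open>\<sigma> []\<close>, because the
  robbers are placed after seeing that vertex.\<close>

lemma exists_play:
  assumes \<sigma>: "cop_strategy G \<sigma>"
    and q: "\<And>i. causal (q i)"
    and legal: "\<And>i c. walk G c \<Longrightarrow> c 0 = \<sigma> [] \<Longrightarrow> walk G (q i c)"
  obtains c where "walk G c" "c 0 = \<sigma> []" "play G s c (config s q c)"
    "follows \<sigma> c (config s q c)"
proof -
  \<comment> \<open>\<open>H t\<close> is the history before round \<open>t\<close>. The indexed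
    list stands for the cop's trajectory up to round \<open>t\<close>; its values beyond that are
    arbitrary, which \<open>config_cong\<close> permits.\<close>
  define H where "H = rec_nat []
    (\<lambda>t h. h @ [(\<sigma> h, config s q (\<lambda>u. (map fst h @ [\<sigma> h]) ! u) t)])"
  define c where "c t = \<sigma> (H t)" for t
  have H_0: "H 0 = []" by (simp add: H_def)
  have H_Suc: "H (Suc t) = H t @ [(c t, config s q (\<lambda>u. (map fst (H t) @ [c t]) ! u) t)]" for t
    by (simp add: H_def c_def)
  have H: "H t = map (\<lambda>k. (c k, config s q c k)) [0..<t]" for t
  proof (induction t)
    case 0
    then show ?case by (simp add: H_0)
  next
    case (Suc t)
    have fsts: "map fst (H t) @ [c t] = map c [0..<Suc t]"
      by (simp add: Suc)
    have "config s q (\<lambda>u. (map fst (H t) @ [c t]) ! u) t = config s q c t"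
      unfolding fsts by (rule config_cong[OF q]) (simp del: upt_Suc)
    then show ?case by (simp add: H_Suc Suc)
  qed
  have c0: "c 0 = \<sigma> []" by (simp add: c_def H_0)
  have step_c: "step G (c t) (c (Suc t))" if "c t \<in> pverts G" for t
  proof -
    have "H (Suc t) \<noteq> []" "fst (last (H (Suc t))) = c t" by (simp_all add: H_Suc)
    with \<sigma> that show ?thesis unfolding cop_strategy_def c_def[of "Suc t"] by metis
  qed
  have "c t \<in> pverts G" for t
  proof (induction t)
    case 0
    then show ?case using \<sigma> c0 by (simp add: cop_strategy_def)
  next
    case (Suc t)
    then show ?case using step_c by (simp add: step_def)
  qed
  with step_c have w: "walk G c" by (simp add: walk_def)
  moreover have "follows \<sigma> c (config s q c)"
    unfolding follows_def H[symmetric] by (simp add: c_def)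
  ultimately show thesis
    using that w c0 play_config[where q = q, OF w] legal[OF w c0] by metis
qed

section \<open>Walks on a path\<close>

lemma step_path: "step (path_graph n) u v \<Longrightarrow> v < n \<and> u \<le> Suc v \<and> v \<le> Suc u"
  by (auto simp: step_def path_graph_def)

lemma step_pathI: "u < n \<Longrightarrow> v < n \<Longrightarrow> u \<le> Suc v \<Longrightarrow> v \<le> Suc u \<Longrightarrow> step (path_graph n) u v"
  by (auto simp: step_def path_graph_def)

lemma walk_path_iff:
  "walk (path_graph n) p \<longleftrightarrow> (\<forall>t. p t < n \<and> p t \<le> Suc (p (Suc t)) \<and> p (Suc t) \<le> Suc (p t))"
proof
  assume w: "walk (path_graph n) p"
  then have "p t < n" for t using walk_in_pverts[OF w, of t] by (simp add: path_graph_def)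
  with w show "\<forall>t. p t < n \<and> p t \<le> Suc (p (Suc t)) \<and> p (Suc t) \<le> Suc (p t)"
    by (auto simp: walk_def dest: step_path)
next
  assume "\<forall>t. p t < n \<and> p t \<le> Suc (p (Suc t)) \<and> p (Suc t) \<le> Suc (p t)"
  then show "walk (path_graph n) p"
    by (auto simp: walk_def intro: step_pathI) (simp add: path_graph_def)
qed

lemma walk_path_speed:
  assumes "walk (path_graph n) p"
  shows "p (t + d) \<le> p t + d" "p t \<le> p (t + d) + d"
proof -
  have "p (t + d) \<le> p t + d \<and> p t \<le> p (t + d) + d"
  proof (induction d)
    case (Suc d)
    have "p (t + d) \<le> Suc (p (Suc (t + d))) \<and> p (Suc (t + d)) \<le> Suc (p (t + d))"
      using assms by (simp add: walk_path_iff)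
    with Suc show ?case by simp
  qed simp
  then show "p (t + d) \<le> p t + d" "p t \<le> p (t + d) + d" by auto
qed

text \<open>A discrete intermediate value theorem.\<close>

lemma walk_path_hits:
  assumes w: "walk (path_graph n) p" and "p 0 \<le> v" "v \<le> p T"
  shows "\<exists>t\<le>T. p t = v"
  using assms(3)
proof (induction T)
  case 0
  with assms(2) show ?case by auto
next
  case (Suc T)
  show ?case
  proof (cases "v \<le> p T")
    case True
    with Suc.IH show ?thesis by (meson le_Suc_eq)
  next
    case False
    moreover have "p (Suc T) \<le> Suc (p T)" using w by (simp add: walk_path_iff)
    ultimately show ?thesis using Suc.prems by (intro exI[of _ "Suc T"]) auto
  qed
qed

section \<open>A robber shadowing the cop from the right\<close>

text \<open>
  A robber right of the cop that keeps distance 2 (as far as the path permits) is caught only once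
  the cop has reached the right end.
\<close>

lemma spoiled_shadow:
  assumes c: "walk (path_graph n) c"
    and p: "\<And>t. min (n - 1) (c t + 2) \<le> p t"
    and c_less: "\<And>u. u \<le> Suc t \<Longrightarrow> c u < n - 1"
  shows "p t \<in> spoiled c p"
proof -
  have "p u \<noteq> c u" if "u \<le> Suc t" for u
    using p[of u] c_less[OF that] by (auto simp: min_def split: if_splits)
  \<comment> \<open>The cop gains at most one vertex on a gap of two; where the gap is cut short,
    the robber is on \<open>n - 1\<close>, which the cop has not reached.\<close>
  moreover have "p u \<noteq> c (Suc u)" if "u < Suc t" for u
  proof -
    have "c (Suc u) \<le> Suc (c u)" using c by (simp add: walk_path_iff)
    then show ?thesis
      using p[of u] c_less[of "Suc u"] that by (auto simp: min_def split: if_splits)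
  qed
  ultimately show ?thesis by (auto simp: spoiled_def uncaught_def)
qed

text \<open>Up to its first arrival at the right end the robber meets every vertex from
  \<open>c 0 + 2\<close> on, and the cop is still too far away to reach that end.\<close>

lemma spoiled_shadow_right:
  assumes c: "walk (path_graph n) c" and p: "walk (path_graph n) p"
    and p_ge: "\<And>t. min (n - 1) (c t + 2) \<le> p t"
    and p0: "p 0 = min (n - 1) (c 0 + 2)" and reach: "p T = n - 1"
  shows "{c 0 + 2..<n} \<subseteq> spoiled c p"
proof
  fix v assume v: "v \<in> {c 0 + 2..<n}"
  define F where "F = (LEAST t. p t = n - 1)"
  have F: "p F = n - 1" unfolding F_def by (rule LeastI[of _ T]) (rule reach)
  have before: "c u + 4 \<le> n" if "u < F" for u
  proof -
    have "p u \<noteq> n - 1" using not_less_Least that unfolding F_def by blast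
    moreover have "p u < n" using p by (simp add: walk_path_iff)
    ultimately show ?thesis using p_ge[of u] by (auto simp: min_def split: if_splits)
  qed
  \<comment> \<open>To damage \<open>n - 1\<close> the robber must also survive round
    \<open>Suc F\<close>, so the cop needs two moves of slack at time \<open>F\<close>. For
    \<open>F = 0\<close> the slack comes from \<open>c 0 + 2 \<le> v < n\<close>.\<close>
  have cF: "c F + 3 \<le> n"
  proof (cases F)
    case 0
    with v show ?thesis by simp
  next
    case (Suc F')
    have "c (Suc F') \<le> Suc (c F')" using c by (simp add: walk_path_iff)
    with before[of F'] Suc show ?thesis by simp
  qed
  have "c (Suc F) \<le> Suc (c F)" using c by (simp add: walk_path_iff)
  with cF before have c_less: "c u < n - 1" if "u \<le> Suc F" for u
    using that by (cases "u < F"; cases "u = F") (force simp: le_Suc_eq)+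
  obtain t where "t \<le> F" "p t = v"
    using walk_path_hits[OF p, of v F] v p0 F by fastforce
  with spoiled_shadow[OF c p_ge, of t] c_less show "v \<in> spoiled c p" by simp
qed

section \<open>The trajectories of the two robbers\<close>

text \<open>
  Truncated subtraction: the first summand is the way out, the second the way back. For \<open>a \<le> 1\<close>
  the robber stays on 0.
\<close>

definition left_robber :: "nat \<Rightarrow> nat \<Rightarrow> nat" where
  "left_robber a t = (a - 2 - t) + min (t - (a - 1)) (a - 1)"

text \<open>For \<open>a \<ge> 1\<close> the left robber enters \<open>a - 1\<close> in round
  \<open>2 * a - 2\<close>; shadowing may last one round longer, until it is settled whether
  \<open>a - 1\<close> is damaged. The test looks at the cop up to round \<open>t\<close>, not
  \<open>Suc t\<close>: when the cop first steps left of \<open>a\<close>, this robber still follows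
  and so can land on \<open>a + 1\<close>.\<close>

fun right_robber :: "nat \<Rightarrow> nat \<Rightarrow> (nat \<Rightarrow> nat) \<Rightarrow> nat \<Rightarrow> nat" where
  "right_robber n a c 0 = min (n - 1) (c 0 + 2)"
| "right_robber n a c (Suc t) =
     (if (\<forall>u\<le>t. a \<le> c u) \<and> t \<le> 2 * a - 2 then min (n - 1) (c (Suc t) + 2)
      else min (n - 1) (Suc (right_robber n a c t)))"

lemma causal_right_robber: "causal (right_robber n a)"
  unfolding causal_def
proof (intro allI)
  fix c c' t
  show "(\<forall>u\<le>t. c u = c' u) \<longrightarrow> right_robber n a c t = right_robber n a c' t"
    by (induction t) auto
qed

text \<open>Fleeing at full speed preserves the gap gained by shadowing, so the bound holds in both
  phases.\<close>

lemma right_robber_ge: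
  assumes "walk (path_graph n) c"
  shows "min (n - 1) (c t + 2) \<le> right_robber n a c t"
proof (induction t)
  case (Suc t)
  have "c (Suc t) \<le> Suc (c t)" using assms by (simp add: walk_path_iff)
  with Suc show ?case by auto
qed simp

lemma right_robber_shadows:
  assumes "\<And>u. u < t \<Longrightarrow> a \<le> c u" "t \<le> Suc (2 * a - 2)"
  shows "right_robber n a c t = min (n - 1) (c t + 2)"
  using assms by (cases t) auto

lemma walk_right_robber:
  assumes "walk (path_graph n) c"
  shows "walk (path_graph n) (right_robber n a c)"
  unfolding walk_path_iff
proof
  fix t
  let ?R = "right_robber n a c"
  have n: "0 < n" using assms by (metis walk_path_iff gr_zeroI less_zeroE)
  have "?R t \<le> n - 1" by (cases t) auto
  with n have R: "?R t < n" by simp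
  show "?R t < n \<and> ?R t \<le> Suc (?R (Suc t)) \<and> ?R (Suc t) \<le> Suc (?R t)"
  proof (cases "(\<forall>u\<le>t. a \<le> c u) \<and> t \<le> 2 * a - 2")
    case True
    then have "?R t = min (n - 1) (c t + 2)" by (intro right_robber_shadows) auto
    moreover have "?R (Suc t) = min (n - 1) (c (Suc t) + 2)" using True by simp
    moreover have "c (Suc t) \<le> Suc (c t)" "c t \<le> Suc (c (Suc t))"
      using assms by (simp_all add: walk_path_iff)
    ultimately show ?thesis using R by linarith
  next
    case False
    then have "?R (Suc t) = min (n - 1) (Suc (?R t))" by auto
    then show ?thesis using R by linarith
  qed
qed

lemma right_robber_reaches: "\<exists>t. right_robber n a c t = n - 1"
proof -
  \<comment> \<open>After round \<open>Suc (2 * a - 2)\<close> shadowing is over whatever the cop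
    does, and each round gains a vertex.\<close>
  have "min (n - 1) d \<le> right_robber n a c (Suc (2 * a - 2) + d)" for d
  proof (induction d)
    case (Suc d)
    have "right_robber n a c (Suc (2 * a - 2) + Suc d) =
        min (n - 1) (Suc (right_robber n a c (Suc (2 * a - 2) + d)))"
      by (simp del: One_nat_def)
    with Suc show ?case by linarith
  qed simp
  from this[of "n - 1"] have "n - 1 \<le> right_robber n a c (Suc (2 * a - 2) + (n - 1))" by simp
  moreover have "right_robber n a c t \<le> n - 1" for t by (cases t) auto
  ultimately show ?thesis using le_antisym by blast
qed

lemma walk_left_robber: "a < n \<Longrightarrow> walk (path_graph n) (left_robber a)"
  by (auto simp: walk_path_iff left_robber_def min_def)

text \<open>The robber starts two vertices ahead and runs at full speed, so the cop cannot catch it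
  on the way out.\<close>

lemma spoiled_left_robber_outer:
  assumes c: "walk (path_graph n) c" and "c 0 = a"
  shows "{..<a - 1} \<subseteq> spoiled c (left_robber a)"
proof
  fix v assume "v \<in> {..<a - 1}"
  then have v: "v < a - 1" by simp
  define t where "t = a - 2 - v"
  have t: "t \<le> a - 2" "left_robber a t = v" using v by (auto simp: t_def left_robber_def)
  have c_ge: "a \<le> c u + u" for u
    using walk_path_speed(2)[OF c, of 0 u] assms(2) by simp
  \<comment> \<open>Truncation makes this hold through round \<open>a - 1\<close>, the round of
    waiting on 0, which is the one to survive for damaging 0.\<close>
  have p: "left_robber a u = a - 2 - u" if "u \<le> Suc t" for u
    using that t v by (auto simp: left_robber_def)
  have "uncaught c (left_robber a) (Suc t)"
    unfolding uncaught_def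
  proof (intro conjI allI impI)
    fix u assume "u \<le> Suc t"
    with p[of u] c_ge[of u] t v show "left_robber a u \<noteq> c u" by simp
  next
    fix u assume "u < Suc t"
    with p[of u] c_ge[of "Suc u"] t v show "left_robber a u \<noteq> c (Suc u)" by simp
  qed
  with t(2) show "v \<in> spoiled c (left_robber a)" by (auto simp: spoiled_def)
qed

text \<open>The robber always stays left of \<open>a\<close> and the cop does not, so they cannot
  meet before \<open>a - 1\<close> is damaged.\<close>

lemma spoiled_left_robber_inner:
  assumes "\<And>u. u \<le> Suc (2 * a - 2) \<Longrightarrow> a \<le> c u" "1 \<le> a"
  shows "a - 1 \<in> spoiled c (left_robber a)"
proof -
  have less: "left_robber a u < a" for u using assms(2) by (auto simp: left_robber_def)
  have "uncaught c (left_robber a) (Suc (2 * a - 2))"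
    unfolding uncaught_def using assms(1) less by (metis Suc_leI not_le)
  moreover have "left_robber a (2 * a - 2) = a - 1"
    using assms(2) by (auto simp: left_robber_def)
  ultimately show ?thesis by (force simp: spoiled_def)
qed

text \<open>All vertices except \<open>a - 1\<close>, \<open>a\<close>, \<open>a + 1\<close> are
  damaged in any case. If \<open>a = 0\<close>, these already number \<open>n - 2\<close>; otherwise
  one of \<open>a - 1\<close> and \<open>a + 1\<close> is gained, depending on whether the cop goes
  left of \<open>a\<close> by round \<open>2 * a - 1\<close>.\<close>

lemma spoiled_left_half:
  assumes c: "walk (path_graph n) c" and a: "c 0 = a" "2 * a \<le> n - 1"
  shows "n - 2 \<le> card (spoiled c (left_robber a) \<union> spoiled c (right_robber n a c))"
    (is "_ \<le> card ?D")
proof -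
  note R_ge = right_robber_ge[OF c]
  have "c 0 < n" using c by (simp add: walk_path_iff)
  then have "a < n" using a by simp
  have sub: "?D \<subseteq> {..<n}"
    using walk_left_robber[OF \<open>a < n\<close>] walk_right_robber[OF c, of a]
    by (auto simp: spoiled_def walk_path_iff)
  have fin: "finite ?D" using finite_subset[OF sub] by simp
  have outer: "{..<a - 1} \<subseteq> ?D" using spoiled_left_robber_outer[OF c a(1)] by blast
  obtain T where "right_robber n a c T = n - 1" using right_robber_reaches by blast
  then have right: "{a + 2..<n} \<subseteq> ?D"
    using spoiled_shadow_right[OF c walk_right_robber[OF c] R_ge] a(1) by auto
  consider "a = 0" | "1 \<le> a" "\<forall>u\<le>Suc (2 * a - 2). a \<le> c u"
    | "1 \<le> a" "\<exists>u\<le>Suc (2 * a - 2). c u < a" by fastforce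
  then show ?thesis
  proof cases
    case 1
    with right card_mono[OF fin right] show ?thesis by simp
  next
    case 2
    then have "a - 1 \<in> ?D" using spoiled_left_robber_inner by blast
    with outer right have "({..<a - 1} \<union> {a - 1}) \<union> {a + 2..<n} \<subseteq> ?D" by blast
    moreover have "{..<a - 1} \<union> {a - 1} = {..<a}" using 2(1) by auto
    ultimately have "card ({..<a} \<union> {a + 2..<n}) \<le> card ?D" using card_mono[OF fin] by metis
    moreover have "card ({..<a} \<union> {a + 2..<n}) = a + (n - (a + 2))"
      by (subst card_Un_disjoint) auto
    ultimately show ?thesis by simp
  next
    case 3
    define k where "k = (LEAST u. c u < a)"
    obtain w where w: "w \<le> Suc (2 * a - 2)" "c w < a" using 3 by blast
    have k: "c k < a" unfolding k_def using w(2) by (rule LeastI)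
    have k_le: "k \<le> Suc (2 * a - 2)" using w Least_le[of "\<lambda>u. c u < a" w] by (simp add: k_def)
    have before: "a \<le> c u" if "u < k" for u
      using not_less_Least that unfolding k_def by (metis not_less)
    have "k \<noteq> 0" using k a(1) by (metis less_irrefl)
    then obtain k' where k': "k = Suc k'" using not0_implies_Suc by blast
    have "c k' \<le> Suc (c k)" using c k' by (simp add: walk_path_iff)
    with before[of k'] k k' have ck: "c k = a - 1" by simp
    have "right_robber n a c k = min (n - 1) (c k + 2)"
      using before k_le by (rule right_robber_shadows)
    with ck 3(1) a(2) have Rk: "right_robber n a c k = a + 1" by auto
    have c_less: "c u < n - 1" if "u \<le> Suc k" for u
    proof (cases "u \<le> k")
      case True
      \<comment> \<open>The cop must be back on \<open>a - 1\<close> in round \<open>k\<close>.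
        Adding both bounds gives \<open>2 * c u \<le> 2 * a - 1 + k \<le> 4 * a - 2\<close>, hence
        \<open>c u < 2 * a \<le> n - 1\<close>.\<close>
      then have "c u \<le> a - 1 + (k - u)" "c u \<le> a + u"
        using walk_path_speed(2)[OF c, of u "k - u"] walk_path_speed(1)[OF c, of 0 u] ck a(1)
        by auto
      with k_le a(2) 3(1) True show ?thesis by linarith
    next
      case False
      with that have "u = Suc k" by simp
      moreover have "c (Suc k) \<le> Suc (c k)" using c by (simp add: walk_path_iff)
      ultimately show ?thesis using ck 3(1) a(2) by simp
    qed
    have "a + 1 \<in> ?D" using spoiled_shadow[OF c R_ge[of _ a], of k] c_less Rk by auto
    with outer right have "{..<a - 1} \<union> ({a + 1} \<union> {a + 2..<n}) \<subseteq> ?D" by blast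
    moreover have "{a + 1} \<union> {a + 2..<n} = {a + 1..<n}" using 3(1) a(2) by auto
    ultimately have "card ({..<a - 1} \<union> {a + 1..<n}) \<le> card ?D" using card_mono[OF fin] by metis
    moreover have "card ({..<a - 1} \<union> {a + 1..<n}) = (a - 1) + (n - (a + 1))"
      by (subst card_Un_disjoint) auto
    ultimately show ?thesis using 3(1) by simp
  qed
qed

section \<open>All starting vertices, by reflection\<close>

definition evadable :: "nat \<Rightarrow> nat \<Rightarrow> bool" where
  "evadable n a \<longleftrightarrow> (\<exists>L R. causal L \<and> causal R \<and>
     (\<forall>c. walk (path_graph n) c \<and> c 0 = a \<longrightarrow>
        walk (path_graph n) (L c) \<and> walk (path_graph n) (R c) \<and>
        n - 2 \<le> card (spoiled c (L c) \<union> spoiled c (R c))))"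

lemma evadable_left_half:
  assumes "2 * a \<le> n - 1" "a < n"
  shows "evadable n a"
  unfolding evadable_def
proof (intro exI conjI allI impI; (elim conjE)?)
  show "causal (\<lambda>_. left_robber a)" by (simp add: causal_def)
  show "causal (right_robber n a)" by (rule causal_right_robber)
  fix c assume c: "walk (path_graph n) c" "c 0 = a"
  show "walk (path_graph n) (left_robber a)" using assms(2) by (rule walk_left_robber)
  show "walk (path_graph n) (right_robber n a c)" using c(1) by (rule walk_right_robber)
  show "n - 2 \<le> card (spoiled c (left_robber a) \<union> spoiled c (right_robber n a c))"
    using c assms(1) by (rule spoiled_left_half)
qed

lemma walk_mirror:
  assumes "walk (path_graph n) p"
  shows "walk (path_graph n) (\<lambda>t. n - 1 - p t)"
  unfolding walk_path_iff
proof
  fix t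
  have "p t < n" "p (Suc t) < n" "p t \<le> Suc (p (Suc t))" "p (Suc t) \<le> Suc (p t)"
    using assms by (simp_all add: walk_path_iff)
  then show "n - 1 - p t < n \<and> n - 1 - p t \<le> Suc (n - 1 - p (Suc t)) \<and>
      n - 1 - p (Suc t) \<le> Suc (n - 1 - p t)" by linarith
qed

lemma spoiled_mirror:
  assumes "walk (path_graph n) c" "walk (path_graph n) p"
  shows "spoiled c (\<lambda>t. n - 1 - p t) = (\<lambda>v. n - 1 - v) ` spoiled (\<lambda>t. n - 1 - c t) p"
proof -
  \<comment> \<open>Subtraction is truncated, so reflection is an involution only on vertices; hence
    the bounds from the walks.\<close>
  have "n - 1 - p t = c u \<longleftrightarrow> p t = n - 1 - c u" for t u
  proof -
    have "p t < n" "c u < n" using assms by (simp_all add: walk_path_iff)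
    then show ?thesis by linarith
  qed
  then have "uncaught c (\<lambda>t. n - 1 - p t) t \<longleftrightarrow> uncaught (\<lambda>t. n - 1 - c t) p t" for t
    by (simp add: uncaught_def)
  then show ?thesis by (auto simp: spoiled_def)
qed

lemma evadable_mirror:
  assumes "evadable n (n - 1 - a)"
  shows "evadable n a"
proof -
  obtain L R where causal: "causal L" "causal R"
    and LR: "\<And>c. walk (path_graph n) c \<Longrightarrow> c 0 = n - 1 - a \<Longrightarrow>
        walk (path_graph n) (L c) \<and> walk (path_graph n) (R c) \<and>
        n - 2 \<le> card (spoiled c (L c) \<union> spoiled c (R c))"
    using assms unfolding evadable_def by blast
  \<comment> \<open>\<open>M q\<close> consults \<open>q\<close> about the reflected cop and
    reflects the answer.\<close>
  define M where "M q c t = n - 1 - q (\<lambda>u. n - 1 - c u) t"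
    for q :: "(nat \<Rightarrow> nat) \<Rightarrow> nat \<Rightarrow> nat" and c t
  have M_causal: "causal (M q)" if "causal q" for q
    unfolding causal_def
  proof (intro allI impI)
    fix c c' :: "nat \<Rightarrow> nat" and t assume "\<forall>u\<le>t. c u = c' u"
    then have "q (\<lambda>u. n - 1 - c u) t = q (\<lambda>u. n - 1 - c' u) t"
      by (intro causalD[OF that]) simp
    then show "M q c t = M q c' t" by (simp add: M_def)
  qed
  have "walk (path_graph n) (M L c) \<and> walk (path_graph n) (M R c) \<and>
      n - 2 \<le> card (spoiled c (M L c) \<union> spoiled c (M R c))"
    if c: "walk (path_graph n) c" "c 0 = a" for c
  proof -
    define d where "d t = n - 1 - c t" for t
    have d: "walk (path_graph n) d" "d 0 = n - 1 - a"
      using walk_mirror[OF c(1)] c(2) by (simp_all add: d_def[abs_def])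
    note LRd = LR[OF d]
    have M: "M q c = (\<lambda>t. n - 1 - q d t)" for q by (simp add: M_def d_def[abs_def] fun_eq_iff)
    let ?S = "spoiled d (L d) \<union> spoiled d (R d)"
    have "spoiled c (M L c) \<union> spoiled c (M R c) = (\<lambda>v. n - 1 - v) ` ?S"
      using spoiled_mirror[OF c(1)] LRd by (simp add: M image_Un d_def[abs_def])
    moreover have "inj_on (\<lambda>v. n - 1 - v) ?S"
    proof (rule inj_on_subset)
      show "?S \<subseteq> {..<n}" using LRd by (auto simp: spoiled_def walk_path_iff)
      show "inj_on (\<lambda>v. n - 1 - v) {..<n}" by (auto simp: inj_on_def)
    qed
    ultimately show ?thesis using LRd walk_mirror by (simp add: M card_image)
  qed
  then show ?thesis using causal M_causal unfolding evadable_def by blast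
qed

lemma evadable:
  assumes "a < n"
  shows "evadable n a"
proof (cases "2 * a \<le> n - 1")
  case True
  then show ?thesis using assms by (rule evadable_left_half)
next
  case False
  then have "evadable n (n - 1 - a)" using assms by (intro evadable_left_half) auto
  then show ?thesis by (rule evadable_mirror)
qed

section \<open>Lower bound against every cop strategy\<close>

lemma guarantees_path_ge:
  assumes \<sigma>: "cop_strategy (path_graph n) \<sigma>" "guarantees (path_graph n) s \<sigma> d" and s: "2 \<le> s"
  shows "n - 2 \<le> d"
proof -
  have "\<sigma> [] < n" using \<sigma>(1) by (simp add: cop_strategy_def path_graph_def)
  from evadable[OF this] obtain L R where LR: "causal L" "causal R"
    "\<And>c. walk (path_graph n) c \<Longrightarrow> c 0 = \<sigma> [] \<Longrightarrow>
        walk (path_graph n) (L c) \<and> walk (path_graph n) (R c) \<and>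
        n - 2 \<le> card (spoiled c (L c) \<union> spoiled c (R c))"
    unfolding evadable_def by blast
  \<comment> \<open>Robbers beyond the second merely copy \<open>R\<close>.\<close>
  define q where "q i = (if i = 0 then L else R)" for i :: nat
  obtain c where c: "walk (path_graph n) c" "c 0 = \<sigma> []"
    "play (path_graph n) s c (config s q c)" "follows \<sigma> c (config s q c)"
  proof (rule exists_play[OF \<sigma>(1), of q s])
    show "causal (q i)" for i using LR by (simp add: q_def)
    show "walk (path_graph n) (q i c)" if "walk (path_graph n) c" "c 0 = \<sigma> []" for i c
      using LR(3)[OF that] by (simp add: q_def)
  qed
  have "finite (damaged (config s q c))"
    using damaged_subset[OF c(3)] by (rule finite_subset) (simp add: path_graph_def)
  moreover have "spoiled c (L c) \<union> spoiled c (R c) \<subseteq> damaged (config s q c)"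
    using s UN_upper[of 0 "{..<s}" "\<lambda>i. spoiled c (q i c)"]
      UN_upper[of 1 "{..<s}" "\<lambda>i. spoiled c (q i c)"]
    by (simp add: damaged_config q_def)
  ultimately have "card (spoiled c (L c) \<union> spoiled c (R c)) \<le> card (damaged (config s q c))"
    by (rule card_mono)
  also have "\<dots> \<le> d" using \<sigma>(2) c by (simp add: guarantees_def)
  finally show ?thesis using LR(3)[OF c(1,2)] by simp
qed

section \<open>The cop's strategy and the upper bound\<close>

text \<open>A history of length 1 means that round 1 is next, which tells the first stay on 1 from
  the final one. The last branch also keeps the move legal on histories that never arise.\<close>

definition guard :: "(nat \<times> nat option list) list \<Rightarrow> nat" where
  "guard h = (if h = [] then 1
     else if length h = 1 \<and> fst (last h) = 1 then 0
     else if fst (last h) = 0 then 1 else fst (last h))"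

lemma cop_strategy_guard:
  assumes "2 \<le> n"
  shows "cop_strategy (path_graph n) guard"
  using assms by (auto simp: cop_strategy_def guard_def step_def path_graph_def)

lemma follows_guard:
  assumes "follows guard c r"
  shows "c 0 = 1" "c (Suc 0) = 0" "c (Suc (Suc t)) = 1"
proof -
  have c: "c t = guard (map (\<lambda>k. (c k, r k)) [0..<t])" for t
    using assms unfolding follows_def by (rule spec)
  show c0: "c 0 = 1" by (subst c) (simp add: guard_def)
  show c1: "c (Suc 0) = 0" by (subst c) (simp add: guard_def c0)
  show "c (Suc (Suc t)) = 1"
  proof (induction t)
    case 0
    show ?case by (subst c) (simp add: guard_def c1)
  next
    case (Suc t)
    show ?case by (subst c) (simp add: guard_def Suc)
  qed
qed

lemma play_next:
  assumes "play G s c r" "r (Suc t) ! i = Some v" "i < length (r (Suc t))"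
  shows "i < length (r t)" "v \<noteq> c (Suc t)"
    "\<exists>u. r t ! i = Some u \<and> u \<noteq> c (Suc t) \<and> step G u v"
proof -
  obtain rs where rs: "robbers_turn G (capture (c (Suc t)) (r t)) rs"
    "r (Suc t) = capture (c (Suc t)) rs"
    using assms(1) by (auto simp: play_def)
  have len: "length rs = length (r t)"
    using rs(1) by (auto simp: robbers_turn_def capture_def dest: list_all2_lengthD)
  with rs(2) assms(3) show i: "i < length (r t)" by (simp add: capture_def)
  with len rs(2) assms(2) have v: "rs ! i = Some v" "v \<noteq> c (Suc t)"
    by (auto simp: capture_def split: if_splits)
  then show "v \<noteq> c (Suc t)" by simp
  have "rel_option (step G) (capture (c (Suc t)) (r t) ! i) (rs ! i)"
    using rs(1) i by (auto simp: robbers_turn_def capture_def list_all2_conv_all_nth)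
  with v(1) i show "\<exists>u. r t ! i = Some u \<and> u \<noteq> c (Suc t) \<and> step G u v"
    by (auto simp: capture_def option_rel_Some2 split: if_splits)
qed

lemma guarantees_guard: "guarantees (path_graph n) s guard (n - 2)"
  unfolding guarantees_def
proof (intro allI impI, elim conjE)
  fix c r assume play: "play (path_graph n) s c r" and "follows guard c r"
  note c = follows_guard[OF this(2)]
  have r0: "v \<noteq> 1" if "i < length (r 0)" "r 0 ! i = Some v" for i v
    using play that c(1) by (auto simp: play_def capture_def split: if_splits)
  have r1: "1 \<le> v" if "i < length (r (Suc 0))" "r (Suc 0) ! i = Some v" for i v
    using play_next(2)[OF play that(2,1)] c(2) by simp
  \<comment> \<open>The move to 1 in round 2 removes robbers there; from then on the cop on 1
    separates the others from 0.\<close>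
  have late: "2 \<le> v" if "i < length (r (Suc (Suc t)))" "r (Suc (Suc t)) ! i = Some v" for i t v
    using that
  proof (induction t arbitrary: v)
    case 0
    obtain u where u: "r (Suc 0) ! i = Some u" "u \<noteq> 1" "step (path_graph n) u v"
      using play_next(3)[OF play 0(2,1)] c(3) by auto
    have "v \<noteq> 1" using play_next(2)[OF play 0(2,1)] c(3) by simp
    moreover have "1 \<le> u" using r1 u(1) play_next(1)[OF play 0(2,1)] by blast
    ultimately show ?case using u step_path[OF u(3)] by linarith
  next
    case (Suc t)
    obtain u where u: "r (Suc (Suc t)) ! i = Some u" "step (path_graph n) u v"
      using play_next(3)[OF play Suc.prems(2,1)] by auto
    have "v \<noteq> 1" using play_next(2)[OF play Suc.prems(2,1)] c(3) by simp
    moreover have "2 \<le> u" using Suc.IH u(1) play_next(1)[OF play Suc.prems(2,1)] by blast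
    ultimately show ?case using step_path[OF u(2)] by linarith
  qed
  have len: "length (r (Suc t)) = length (r t)" for t
  proof -
    obtain rs where "robbers_turn (path_graph n) (capture (c (Suc t)) (r t)) rs"
      "r (Suc t) = capture (c (Suc t)) rs"
      using play unfolding play_def by blast
    then show ?thesis by (auto simp: robbers_turn_def capture_def dest: list_all2_lengthD)
  qed
  have "damaged r \<subseteq> {2..<n}"
  proof
    fix v assume dam: "v \<in> damaged r"
    then obtain t i v' where i: "i < length (r t)" "r t ! i = Some v" "r (Suc t) ! i = Some v'"
      by (auto simp: damaged_def)
    \<comment> \<open>Damage also requires escaping the cop's next move, which excludes 0 in round 0
      and 1 in round 1.\<close>
    have v: "v \<noteq> c (Suc t)" using play_next(3)[OF play i(3)] i len[of t] by auto
    consider "t = 0" | "t = Suc 0" | t' where "t = Suc (Suc t')"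
      by (metis not0_implies_Suc)
    then have "2 \<le> v"
    proof cases
      case 1
      with i r0[of i v] v c(2) show ?thesis by simp
    next
      case 2
      with i r1[of i v] v c(3)[of 0] show ?thesis by simp
    next
      case 3
      with i late show ?thesis by blast
    qed
    moreover have "v < n" using dam damaged_subset[OF play] by (auto simp: path_graph_def)
    ultimately show "v \<in> {2..<n}" by simp
  qed
  then have "card (damaged r) \<le> card {2..<n}" by (intro card_mono) auto
  then show "card (damaged r) \<le> n - 2" by simp
qed

theorem theorem3p3:
  fixes n s :: nat
  assumes "n \<ge> 2" and "s \<ge> 2"
  shows "dmg (path_graph n) s = n - 2"
  unfolding dmg_def
proof (rule Least_equality)
  show "\<exists>\<sigma>. cop_strategy (path_graph n) \<sigma> \<and> guarantees (path_graph n) s \<sigma> (n - 2)"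
    using cop_strategy_guard[OF assms(1)] guarantees_guard by blast
  show "n - 2 \<le> d"
    if "\<exists>\<sigma>. cop_strategy (path_graph n) \<sigma> \<and> guarantees (path_graph n) s \<sigma> d" for d
    using that guarantees_path_ge assms(2) by blast
qed

end
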